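(* There are absolute constants $c, c_1, c_2 > 0$ such that for every sufficiently large integer $N$ there exists a set of integers $\{a_1 < \cdots < a_n\} \subset \{1, \ldots, N\}$ with $n \asymp \frac{N}{2}$, i.e. $c_1 \frac N2 \le n \le c_2 \frac N2$, such that $$M(a_1, \ldots, a_n) < \exp\big(c \sqrt{n}\, \sqrt{\log n}\, \log\log n\big).$$
   Context: For positive integers $a_1 < \cdots < a_n$ define $$M(a_1, \ldots, a_n) = \max_{|z|=1} \prod_{i=1}^n |1 - z^{a_i}|,$$ the maximum being over complex numbers $z$ of modulus 1. The notation $A \asymp B$ means that $A$ and $B$ are of the same order, i.e. each is bounded by an absolute constant times the other. *)

theory Defs
  imports "HOL-Analysis.Analysis"
begin

text \<open>The exponents \<open>a\<^sub>1 < \<dots> < a\<^sub>n\<close> are represented by the set \<open>A\<close> of their values,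
  so that \<open>n = card A\<close>.\<close>

definition M :: "nat set \<Rightarrow> real" where
  "M A = (SUP z \<in> sphere (0::complex) 1. \<Prod>a\<in>A. norm (1 - z ^ a))"

text \<open>The supremum is a maximum.\<close>

lemma M_is_max:
  "\<exists>z\<in>sphere (0::complex) 1. M A = (\<Prod>a\<in>A. norm (1 - z ^ a)) \<and>
     (\<forall>w\<in>sphere (0::complex) 1. (\<Prod>a\<in>A. norm (1 - w ^ a)) \<le> M A)"
proof -
  let ?f = "\<lambda>z::complex. \<Prod>a\<in>A. norm (1 - z ^ a)"
  have "continuous_on (sphere 0 1) ?f"
    by (intro continuous_intros)
  moreover have "sphere (0::complex) 1 \<noteq> {}"
    by simp
  ultimately obtain z where z: "z \<in> sphere 0 1" "\<forall>w\<in>sphere 0 1. ?f w \<le> ?f z"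
    using continuous_attains_sup[of "sphere (0::complex) 1" ?f] by auto
  have "M A = ?f z"
    unfolding M_def using z by (intro cSup_eq_maximum) auto
  with z show ?thesis
    by auto
qed

end

theory Submission
  imports Defs
begin

text \<open>Put each \<open>a \<le> N\<close> into \<open>A\<close> independently with probability \<open>p\<^sub>a = 1 - a / N\<close>. For \<open>0 < s \<le> 1\<close> and
  \<open>z\<close> on the unit circle the mean of \<open>(\<Prod>a\<in>A. \<bar>1 - z\<^sup>a\<bar>) powr (2 s)\<close> is at most
  \<open>exp (\<Sum>a\<le>N. p\<^sub>a (\<bar>1 - z\<^sup>a\<bar> powr (2 s) - 1))\<close>.
  In \<open>(1 - w) powr s = 1 - (\<Sum>j\<ge>1. c\<^sub>j w\<^sup>j)\<close> the \<open>c\<^sub>j\<close> are nonnegative, decreasing and of sum at most 1,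
  so all nonconstant Fourier coefficients of \<open>\<bar>1 - w\<bar> powr (2 s)\<close> are at most 0, while the constant one
  is \<open>1 + (\<Sum>j\<ge>1. c\<^sub>j\<^sup>2) \<le> 1 + 2 s\<^sup>2\<close>. Positivity of the Fejer kernel, whose coefficients are
  the \<open>p\<^sub>a\<close>, therefore bounds the exponent by \<open>1/2 + s\<^sup>2 N\<close>, uniformly in \<open>z\<close>.
  Since \<open>\<Prod>a\<in>A. 1 - z\<^sup>a\<close> is a polynomial of degree at most \<open>N\<^sup>2\<close>, the roots of unity of order \<open>N\<^sup>2 + 1\<close>
  control its maximum up to a factor \<open>N\<^sup>2 + 1\<close>. A union bound over them with
  \<open>s = sqrt (ln N / N)\<close> gives \<open>M A \<le> exp (5 sqrt (N ln N))\<close> with positive probability, without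
  the factor \<open>ln (ln n)\<close>.\<close>

section \<open>The Fejer kernel\<close>

text \<open>The left side is the squared modulus of the sum of e^(imx) over m < N, and each
  difference a > 0 arises from N - a pairs of indices. The induction step adds the correlation of
  the new exponential with the earlier ones.\<close>

lemma norm_exp_sum_sq:
  "(\<Sum>m<N. cos (real m * x))\<^sup>2 + (\<Sum>m<N. sin (real m * x))\<^sup>2
     = real N + 2 * (\<Sum>a=1..N. (real N - real a) * cos (real a * x))"
proof (induction N)
  case 0
  show ?case by simp
next
  case (Suc N)
  let ?C = "\<Sum>m<N. cos (real m * x)" and ?S = "\<Sum>m<N. sin (real m * x)"
  have "?C * cos (real N * x) + ?S * sin (real N * x) = (\<Sum>m<N. cos (real (N - m) * x))"
    unfolding sum_distrib_right sum.distrib[symmetric]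
    by (intro sum.cong) (auto simp: of_nat_diff left_diff_distrib cos_diff)
  also have "\<dots> = (\<Sum>a=1..N. cos (real a * x))"
    by (rule sum.reindex_bij_witness[of _ "\<lambda>a. N - a" "\<lambda>m. N - m"]) auto
  finally have cross: "?C * cos (real N * x) + ?S * sin (real N * x) = (\<Sum>a=1..N. cos (real a * x))" .
  have "(?C + cos (real N * x))\<^sup>2 + (?S + sin (real N * x))\<^sup>2
      = (?C\<^sup>2 + ?S\<^sup>2) + ((cos (real N * x))\<^sup>2 + (sin (real N * x))\<^sup>2)
        + 2 * (?C * cos (real N * x) + ?S * sin (real N * x))"
    by (simp add: power2_eq_square algebra_simps)
  also have "\<dots> = real N + 2 * (\<Sum>a=1..N. (real N - real a) * cos (real a * x)) + 1
        + 2 * (\<Sum>a=1..N. cos (real a * x))"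
    unfolding Suc.IH cross by simp
  also have "\<dots> = real (Suc N) + 2 * (\<Sum>a=1..Suc N. (real (Suc N) - real a) * cos (real a * x))"
    by (simp add: sum_distrib_left sum.distrib[symmetric] algebra_simps)
  finally show ?case by simp
qed

text \<open>Multiplied by 2N, this is the squared modulus in \<open>norm_exp_sum_sq\<close>.\<close>

lemma fejer_kernel_nonneg:
  "0 \<le> 1/2 + (\<Sum>a=1..N. (1 - real a / real N) * cos (real a * x))"
proof (cases "N = 0")
  case False
  have "0 \<le> real N + 2 * (\<Sum>a=1..N. (real N - real a) * cos (real a * x))"
    unfolding norm_exp_sum_sq[symmetric] by simp
  also have "\<dots> = 2 * real N * (1/2 + (\<Sum>a=1..N. (1 - real a / real N) * cos (real a * x)))"
  proof -
    have "(\<Sum>a=1..N. (1 - real a / real N) * cos (real a * x))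
        = (\<Sum>a=1..N. (real N - real a) * cos (real a * x)) / real N"
      unfolding sum_divide_distrib using False by (intro sum.cong) (auto simp: field_simps)
    then show ?thesis using False by (simp add: field_simps)
  qed
  finally show ?thesis using False by (simp add: zero_le_mult_iff)
qed simp

lemma sum_fejer_weights:
  "N > 0 \<Longrightarrow> (\<Sum>a=1..N. 1 - real a / real N) = (real N - 1) / 2"
proof -
  assume N: "N > 0"
  have "(\<Sum>a=1..N. real a) = real N * (real N + 1) / 2"
    by (induction N) (auto simp: field_simps)
  then show ?thesis
    using N by (simp add: sum_subtractf sum_divide_distrib[symmetric] field_simps)
qed

text \<open>Monotonicity of \<open>c\<close> moves an off-diagonal entry \<open>c j * c l\<close> with \<open>j < l\<close> up to
  \<open>c j * c (l - j)\<close>, which depends on \<open>l\<close> through the difference only.\<close>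

lemma toeplitz_form_le:
  fixes c :: "nat \<Rightarrow> real" and T :: "int \<Rightarrow> real"
  assumes c0: "\<And>j. 1 \<le> j \<Longrightarrow> 0 \<le> c j" and cdec: "\<And>j l. 1 \<le> j \<Longrightarrow> j \<le> l \<Longrightarrow> c l \<le> c j"
    and csum: "(\<Sum>j=1..J. c j) \<le> 1" and T0: "\<And>k. 0 \<le> T k" and Tsym: "\<And>k. T (- k) = T k"
  shows "(\<Sum>j=1..J. \<Sum>l=1..J. c j * c l * T (int j - int l))
     \<le> T 0 * (\<Sum>j=1..J. (c j)\<^sup>2) + 2 * (\<Sum>k=1..J. c k * T (int k))"
proof -
  define U where "U j l = (if j < l then c j * (c (l - j) * T (int (l - j))) else 0)" for j l :: nat
  \<comment> \<open>Row j is \<open>c j\<close> times a truncation of one fixed nonnegative sum over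
    k = l - j. Completing that sum makes it independent of j, and the factors \<open>c j\<close>
    then add up to at most 1.\<close>
  have U: "(\<Sum>j=1..J. \<Sum>l=1..J. U j l) \<le> (\<Sum>k=1..J. c k * T (int k))"
  proof -
    have "(\<Sum>l=1..J. U j l) \<le> c j * (\<Sum>k=1..J. c k * T (int k))" if j: "j \<in> {1..J}" for j
    proof -
      have "(\<Sum>l=1..J. U j l) = (\<Sum>l\<in>{j<..J}. c j * (c (l - j) * T (int (l - j))))"
        by (rule sum.mono_neutral_cong_right) (use j in \<open>auto simp: U_def\<close>)
      also have "\<dots> = (\<Sum>k=1..J-j. c j * (c k * T (int k)))"
        by (rule sum.reindex_bij_witness[of _ "\<lambda>k. k + j" "\<lambda>l. l - j"]) auto
      also have "\<dots> \<le> (\<Sum>k=1..J. c j * (c k * T (int k)))"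
        by (rule sum_mono2) (use j c0 T0 in auto)
      finally show ?thesis by (simp add: sum_distrib_left)
    qed
    then have "(\<Sum>j=1..J. \<Sum>l=1..J. U j l) \<le> (\<Sum>j=1..J. c j * (\<Sum>k=1..J. c k * T (int k)))"
      by (rule sum_mono)
    also have "\<dots> = (\<Sum>j=1..J. c j) * (\<Sum>k=1..J. c k * T (int k))"
      by (simp add: sum_distrib_right)
    also have "\<dots> \<le> 1 * (\<Sum>k=1..J. c k * T (int k))"
      by (rule mult_right_mono[OF csum]) (auto intro!: sum_nonneg mult_nonneg_nonneg c0 T0)
    finally show ?thesis by simp
  qed
  have entry: "c j * c l * T (int j - int l) \<le> (if j = l then T 0 * (c j)\<^sup>2 else 0) + U j l + U l j"
    if "j \<in> {1..J}" "l \<in> {1..J}" for j l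
  proof -
    have lt: "c j * c l * T (int j - int l) \<le> U j l"
      if "j < l" "1 \<le> j" for j l
    proof -
      have "c l \<le> c (l - j)" by (rule cdec) (use that in auto)
      moreover have "T (int j - int l) = T (int (l - j))"
        using that Tsym[of "int (l - j)"] by (simp add: of_nat_diff)
      ultimately show ?thesis
        using that by (auto simp: U_def mult.assoc intro!: mult_left_mono mult_right_mono c0 T0)
    qed
    consider "j < l" | "j = l" | "l < j" by linarith
    then show ?thesis
    proof cases
      case 1 then show ?thesis using lt[of j l] that by (simp add: U_def)
    next
      case 2 then show ?thesis by (simp add: U_def power2_eq_square)
    next
      case 3
      have "T (int j - int l) = T (int l - int j)" using Tsym[of "int l - int j"] by simp
      then show ?thesis using 3 lt[of l j] that by (simp add: U_def mult.commute)
    qed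
  qed
  have "(\<Sum>j=1..J. \<Sum>l=1..J. c j * c l * T (int j - int l))
     \<le> (\<Sum>j=1..J. \<Sum>l=1..J. (if j = l then T 0 * (c j)\<^sup>2 else 0) + U j l + U l j)"
    by (intro sum_mono entry)
  also have "\<dots> = T 0 * (\<Sum>j=1..J. (c j)\<^sup>2) + (\<Sum>j=1..J. \<Sum>l=1..J. U j l) + (\<Sum>j=1..J. \<Sum>l=1..J. U l j)"
    by (simp add: sum.distrib sum_distrib_left)
  also have "(\<Sum>j=1..J. \<Sum>l=1..J. U l j) = (\<Sum>j=1..J. \<Sum>l=1..J. U j l)"
    by (rule sum.swap)
  finally show ?thesis using U by linarith
qed

text \<open>Frequencies are written as integers so that, in the Fejer mean, every cosine averages to
  a value of one even function on \<open>int\<close>.\<close>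

lemma norm_one_minus_trig_poly_sq:
  fixes c :: "nat \<Rightarrow> real"
  shows "(norm (1 - (\<Sum>j=1..J. of_real (c j) * cis t ^ j)))\<^sup>2
     = 1 - 2 * (\<Sum>j=1..J. c j * cos (of_int (int j) * t))
       + (\<Sum>j=1..J. \<Sum>l=1..J. c j * c l * cos (of_int (int j - int l) * t))"
proof -
  have "(\<Sum>j=1..J. \<Sum>l=1..J. c j * c l * cos (of_int (int j - int l) * t))
      = (\<Sum>j=1..J. c j * cos (real j * t))\<^sup>2 + (\<Sum>j=1..J. c j * sin (real j * t))\<^sup>2"
    unfolding power2_eq_square sum_product sum.distrib[symmetric]
    by (intro sum.cong) (auto simp: left_diff_distrib cos_diff algebra_simps)
  then show ?thesis
    unfolding cmod_power2 by (simp add: Complex.DeMoivre power2_diff)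
qed

text \<open>Once the square is expanded, each cosine averages to \<open>T k - 1/2\<close>, where
  \<open>T\<close> is even and nonnegative by Fejer positivity. The off-diagonal part of
  \<open>toeplitz_form_le\<close> is exactly what the linear terms subtract, so nothing depending on
  x survives.\<close>

lemma fejer_mean_norm_sq_le:
  fixes c :: "nat \<Rightarrow> real"
  assumes N: "N > 0" and c0: "\<And>j. 1 \<le> j \<Longrightarrow> 0 \<le> c j"
    and cdec: "\<And>j l. 1 \<le> j \<Longrightarrow> j \<le> l \<Longrightarrow> c l \<le> c j" and csum: "(\<Sum>j=1..J. c j) \<le> 1"
  shows "(\<Sum>a=1..N. (1 - real a / real N) * (norm (1 - (\<Sum>j=1..J. of_real (c j) * cis (real a * x) ^ j)))\<^sup>2)
     \<le> real N / 2 * (1 + (\<Sum>j=1..J. (c j)\<^sup>2))"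
proof -
  define p where "p a = 1 - real a / real N" for a
  define S where "S k = (\<Sum>a=1..N. p a * cos (of_int k * (real a * x)))" for k :: int
  define T where "T k = 1/2 + S k" for k
  let ?C = "\<Sum>j=1..J. c j"
  have T0: "0 \<le> T k" for k
    using fejer_kernel_nonneg[of N "of_int k * x"] by (simp add: T_def S_def p_def mult_ac)
  have Tsym: "T (- k) = T k" for k by (simp add: T_def S_def)
  have S00: "S 0 = (real N - 1) / 2"
    using sum_fejer_weights[OF N] by (simp add: S_def p_def)
  then have T00: "T 0 = real N / 2" by (simp add: T_def field_simps)
  have "(\<Sum>a=1..N. p a * (norm (1 - (\<Sum>j=1..J. of_real (c j) * cis (real a * x) ^ j)))\<^sup>2)
     = S 0 - 2 * (\<Sum>j=1..J. c j * S (int j)) + (\<Sum>j=1..J. \<Sum>l=1..J. c j * c l * S (int j - int l))"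
  proof -
    have 1: "(\<Sum>a=1..N. p a * (\<Sum>j=1..J. c j * cos (of_int (int j) * (real a * x)))) = (\<Sum>j=1..J. c j * S (int j))"
      unfolding S_def sum_distrib_left by (subst sum.swap) (simp add: mult_ac)
    have "(\<Sum>a=1..N. p a * (\<Sum>j=1..J. \<Sum>l=1..J. c j * c l * cos (of_int (int j - int l) * (real a * x))))
      = (\<Sum>a=1..N. \<Sum>j=1..J. \<Sum>l=1..J. c j * c l * (p a * cos (of_int (int j - int l) * (real a * x))))"
      by (simp add: sum_distrib_left mult_ac)
    also have "\<dots> = (\<Sum>j=1..J. \<Sum>a=1..N. \<Sum>l=1..J. c j * c l * (p a * cos (of_int (int j - int l) * (real a * x))))"
      by (rule sum.swap)
    also have "\<dots> = (\<Sum>j=1..J. \<Sum>l=1..J. \<Sum>a=1..N. c j * c l * (p a * cos (of_int (int j - int l) * (real a * x))))"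
      by (intro sum.cong refl sum.swap)
    also have "\<dots> = (\<Sum>j=1..J. \<Sum>l=1..J. c j * c l * S (int j - int l))"
      by (simp add: S_def sum_distrib_left)
    finally have 2: "(\<Sum>a=1..N. p a * (\<Sum>j=1..J. \<Sum>l=1..J. c j * c l * cos (of_int (int j - int l) * (real a * x))))
      = (\<Sum>j=1..J. \<Sum>l=1..J. c j * c l * S (int j - int l))" .
    have 3: "(\<Sum>a=1..N. p a) = S 0" by (simp add: S_def)
    show ?thesis
      unfolding norm_one_minus_trig_poly_sq distrib_left right_diff_distrib sum.distrib sum_subtractf
        mult.left_commute[of _ 2] sum_distrib_left[symmetric, of 2] 1 2 mult_1_right 3 by simp
  qed
  \<comment> \<open>Replacing \<open>S\<close> by \<open>T - 1/2\<close> contributes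
    \<open>?C\<close> from the linear terms and \<open>- ?C\<^sup>2 / 2\<close> from the double
    sum.\<close>
  also have "\<dots> = S 0 - 2 * (\<Sum>j=1..J. c j * T (int j)) + ?C
      + (\<Sum>j=1..J. \<Sum>l=1..J. c j * c l * T (int j - int l)) - ?C\<^sup>2 / 2"
  proof -
    have "(\<Sum>j=1..J. \<Sum>l=1..J. c j * c l) = ?C\<^sup>2"
      by (simp add: power2_eq_square sum_product)
    moreover have "(\<Sum>j=1..J. \<Sum>l=1..J. c j * c l * T (int j - int l))
      = (\<Sum>j=1..J. \<Sum>l=1..J. c j * c l) / 2 + (\<Sum>j=1..J. \<Sum>l=1..J. c j * c l * S (int j - int l))"
      by (simp add: T_def distrib_left sum.distrib sum_divide_distrib)
    moreover have "(\<Sum>j=1..J. c j * T (int j)) = ?C / 2 + (\<Sum>j=1..J. c j * S (int j))"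
      by (simp add: T_def distrib_left sum.distrib sum_divide_distrib)
    ultimately show ?thesis by simp
  qed
  also have "\<dots> \<le> S 0 + ?C - ?C\<^sup>2 / 2 + T 0 * (\<Sum>j=1..J. (c j)\<^sup>2)"
    using toeplitz_form_le[of c J T, OF c0 cdec csum T0 Tsym] by linarith
  \<comment> \<open>The square of \<open>1 - ?C\<close> is nonnegative. The remaining 1/2 completes
    \<open>S 0\<close> to N/2.\<close>
  also have "\<dots> \<le> S 0 + 1/2 + T 0 * (\<Sum>j=1..J. (c j)\<^sup>2)"
    using zero_le_power2[of "1 - ?C"] by (simp add: power2_diff)
  also have "\<dots> = real N / 2 * (1 + (\<Sum>j=1..J. (c j)\<^sup>2))"
    unfolding S00 T00 by (simp add: field_simps)
  finally show ?thesis unfolding p_def .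
qed

section \<open>The binomial series of \<open>(1 - w) powr s\<close>\<close>

text \<open>The sign is chosen so that \<open>(1 - w) powr s = 1 - (\<Sum>j\<ge>1. binom_coeff s j * w ^ j)\<close> has
  nonnegative \<open>binom_coeff s j\<close> for \<open>j \<ge> 1\<close>.\<close>

definition binom_coeff :: "real \<Rightarrow> nat \<Rightarrow> real" where
  "binom_coeff s j = - ((- 1) ^ j * (s gchoose j))"

text \<open>For 0 \<le> s \<le> 1 and j \<ge> 1 the ratio (j - s)/(j + 1) of consecutive
  coefficients lies in [0, 1), whence their monotonicity.\<close>

lemma binom_coeff_Suc:
  "real (Suc j) * binom_coeff s (Suc j) = (real j - s) * binom_coeff s j"
proof -
  have "real (Suc j) * (s gchoose Suc j) = (s - real j) * (s gchoose j)"
    using gbinomial_mult_1[of s j] by (simp add: algebra_simps)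
  then have "(- 1) ^ j * (real (Suc j) * (s gchoose Suc j)) = (- 1) ^ j * ((s - real j) * (s gchoose j))"
    by (rule arg_cong)
  then show ?thesis unfolding binom_coeff_def by (simp add: algebra_simps del: of_nat_Suc)
qed

text \<open>This is -f' = s f / (1 - w) for f = (1 - w)^s, read off coefficientwise: division by 1 -
  w forms partial sums. It ties the size and sign of a coefficient to the remainder of the series at
  w = 1.\<close>

lemma binom_coeff_eq_partial_sum:
  "real (Suc J) * binom_coeff s (Suc J) = s * (1 - (\<Sum>j=1..J. binom_coeff s j))"
proof (induction J)
  case 0
  show ?case by (simp add: binom_coeff_def)
next
  case (Suc J)
  show ?case using binom_coeff_Suc[of "Suc J" s] Suc.IH by (simp add: algebra_simps)
qed

text \<open>Each step multiplies the remainder \<open>?q\<close> by 1 - s/(J + 1), which is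
  nonnegative.\<close>

lemma sum_binom_coeff_le_1:
  assumes "0 \<le> s" "s \<le> 1"
  shows "(\<Sum>j=1..J. binom_coeff s j) \<le> 1"
proof (induction J)
  case (Suc J)
  let ?q = "1 - (\<Sum>j=1..J. binom_coeff s j)"
  have "real (Suc J) * (?q - binom_coeff s (Suc J)) = (real (Suc J) - s) * ?q"
    using binom_coeff_eq_partial_sum[of J s] by (simp add: algebra_simps)
  moreover have "0 \<le> (real (Suc J) - s) * ?q"
    using Suc assms by (intro mult_nonneg_nonneg) auto
  ultimately have "0 \<le> real (Suc J) * (?q - binom_coeff s (Suc J))" by simp
  then have "0 \<le> ?q - binom_coeff s (Suc J)"
    by (simp add: zero_le_mult_iff del: of_nat_Suc)
  then show ?case by simp
qed simp

lemma binom_coeff_nonneg: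
  assumes "0 \<le> s" "s \<le> 1" "1 \<le> j"
  shows "0 \<le> binom_coeff s j"
proof -
  obtain J where j: "j = Suc J" using assms(3) by (cases j) auto
  have "0 \<le> real (Suc J) * binom_coeff s (Suc J)"
    unfolding binom_coeff_eq_partial_sum using sum_binom_coeff_le_1[OF assms(1,2), of J] assms by simp
  then show ?thesis by (simp add: j zero_le_mult_iff del: of_nat_Suc)
qed

lemma binom_coeff_le:
  assumes "0 \<le> s" "s \<le> 1" "1 \<le> j"
  shows "binom_coeff s j \<le> s / real j"
proof -
  obtain J where j: "j = Suc J" using assms(3) by (cases j) auto
  have "0 \<le> (\<Sum>j=1..J. binom_coeff s j)"
    by (intro sum_nonneg binom_coeff_nonneg assms) auto
  then have "real (Suc J) * binom_coeff s (Suc J) \<le> s * 1"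
    unfolding binom_coeff_eq_partial_sum using assms by (intro mult_left_mono) auto
  then show ?thesis by (simp add: j field_simps)
qed

lemma binom_coeff_decreasing:
  assumes s: "0 \<le> s" "s \<le> 1" and "1 \<le> j" "j \<le> l"
  shows "binom_coeff s l \<le> binom_coeff s j"
  using assms(4)
proof (induction l rule: dec_induct)
  case (step l)
  have "real (Suc l) * binom_coeff s (Suc l) \<le> real (Suc l) * binom_coeff s l"
    unfolding binom_coeff_Suc using s step assms(3)
    by (intro mult_right_mono binom_coeff_nonneg) auto
  then have "binom_coeff s (Suc l) \<le> binom_coeff s l"
    by (simp del: of_nat_Suc)
  with step show ?case by simp
qed simp

lemma sum_inverse_squares_le_2: "(\<Sum>j=1..J. 1 / (real j)\<^sup>2) \<le> 2"
proof -
  \<comment> \<open>The sharper bound makes the induction telescope, through 1/(j + 1)^2 \<le> 1/j -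
    1/(j + 1).\<close>
  have "(\<Sum>j=1..Suc J. 1 / (real j)\<^sup>2) \<le> 2 - 1 / real (Suc J)" for J
  proof (induction J)
    case (Suc J)
    have "1 / (real (Suc (Suc J)))\<^sup>2 \<le> 1 / (real (Suc J) * real (Suc (Suc J)))"
      unfolding power2_eq_square by (intro divide_left_mono mult_right_mono) auto
    also have "\<dots> = 1 / real (Suc J) - 1 / real (Suc (Suc J))"
      by (simp add: field_simps)
    finally show ?case using Suc by simp
  qed simp
  from this[of "J - 1"] show ?thesis
    by (cases J) (auto intro: order_trans)
qed

lemma sum_binom_coeff_sq_le:
  assumes "0 \<le> s" "s \<le> 1"
  shows "(\<Sum>j=1..J. (binom_coeff s j)\<^sup>2) \<le> 2 * s\<^sup>2"
proof -
  have "(\<Sum>j=1..J. (binom_coeff s j)\<^sup>2) \<le> (\<Sum>j=1..J. s\<^sup>2 * (1 / (real j)\<^sup>2))"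
    using assms binom_coeff_le[OF assms] binom_coeff_nonneg[OF assms]
    by (intro sum_mono) (force simp: power_divide[symmetric] intro!: power_mono)
  also have "\<dots> = s\<^sup>2 * (\<Sum>j=1..J. 1 / (real j)\<^sup>2)"
    by (simp only: sum_distrib_left)
  also have "\<dots> \<le> s\<^sup>2 * 2"
    by (intro mult_left_mono sum_inverse_squares_le_2) auto
  finally show ?thesis by simp
qed

lemma of_real_gbinomial:
  "of_real (s gchoose j) = (of_real s gchoose j :: complex)"
  by (simp add: gbinomial_prod_rev)

lemma one_minus_binom_series_tendsto:
  fixes w :: complex
  assumes "norm w < 1"
  shows "(\<lambda>J. 1 - (\<Sum>j=1..J. of_real (binom_coeff s j) * w ^ j)) \<longlonglongrightarrow> (1 - w) powr of_real s"
proof -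
  have "(\<lambda>n. (of_real s gchoose n) * (- w) ^ n) sums (1 + - w) powr of_real s"
    by (rule gen_binomial_complex) (use assms in simp)
  then have "(\<lambda>J. \<Sum>j\<le>J. (of_real s gchoose j) * (- w) ^ j) \<longlonglongrightarrow> (1 - w) powr of_real s"
    by (simp add: sums_def_le)
  moreover have "(\<Sum>j\<le>J. (of_real s gchoose j) * (- w) ^ j)
      = 1 - (\<Sum>j=1..J. of_real (binom_coeff s j) * w ^ j)" for J
  proof -
    have "(\<Sum>j\<le>J. (of_real s gchoose j) * (- w) ^ j)
        = 1 + (\<Sum>j=1..J. (of_real s gchoose j) * (- w) ^ j)"
      by (simp add: atMost_atLeast0 sum.atLeast_Suc_atMost)
    also have "\<dots> = 1 - (\<Sum>j=1..J. of_real (binom_coeff s j) * w ^ j)"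
      unfolding diff_conv_add_uminus sum_negf[symmetric]
      by (intro arg_cong2[where f = "(+)"] sum.cong refl)
        (simp add: binom_coeff_def of_real_gbinomial power_minus[of w])
    finally show ?thesis .
  qed
  ultimately show ?thesis by simp
qed

text \<open>The summand is the squared modulus of (1 - w)^s, so truncations of the binomial series
  fall under \<open>fejer_mean_norm_sq_le\<close>. Convergence is available only inside the disc;
  hence the radius r < 1, first with J tending to infinity and then r to 1, under a bound free of
  both.\<close>

lemma fejer_mean_norm_powr_le:
  assumes N: "N > 0" and s: "0 < s" "s \<le> 1"
  shows "(\<Sum>a=1..N. (1 - real a / real N) * norm (1 - cis (real a * x)) powr (2 * s))
     \<le> real N / 2 * (1 + 2 * s\<^sup>2)"
proof -
  have inside: "(\<Sum>a=1..N. (1 - real a / real N) * norm (1 - of_real r * cis (real a * x)) powr (2 * s))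
     \<le> real N / 2 * (1 + 2 * s\<^sup>2)" if r: "0 < r" "r < 1" for r
  proof (rule LIMSEQ_le_const2)
    \<comment> \<open>Damping by \<open>r ^ j\<close> preserves sign and monotonicity and only
      decreases the sums of coefficients and of their squares.\<close>
    define c where "c j = binom_coeff s j * r ^ j" for j
    have b0: "0 \<le> binom_coeff s j" if "1 \<le> j" for j
      using s that by (intro binom_coeff_nonneg) auto
    have c_le: "c j \<le> binom_coeff s j" if "1 \<le> j" for j
      using r b0[OF that] by (simp add: c_def mult_left_le power_le_one)
    have c0: "0 \<le> c j" if "1 \<le> j" for j
      using r b0[OF that] by (simp add: c_def)
    have cdec: "c l \<le> c j" if "1 \<le> j" "j \<le> l" for j l
      unfolding c_def using r s that
      by (intro mult_mono binom_coeff_decreasing power_decreasing b0) auto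
    have csum: "(\<Sum>j=1..J. c j) \<le> 1" for J
      using sum_binom_coeff_le_1[of s J] sum_mono[of "{1..J}" c "binom_coeff s"] c_le s by fastforce
    have csq: "(\<Sum>j=1..J. (c j)\<^sup>2) \<le> 2 * s\<^sup>2" for J
    proof -
      have "(\<Sum>j=1..J. (c j)\<^sup>2) \<le> (\<Sum>j=1..J. (binom_coeff s j)\<^sup>2)"
        by (intro sum_mono power_mono c_le c0) auto
      then show ?thesis using sum_binom_coeff_sq_le[of s J] s by simp
    qed
    let ?f = "\<lambda>J (w::complex). norm (1 - (\<Sum>j=1..J. of_real (c j) * w ^ j))"
    have "(\<lambda>J. (?f J w)\<^sup>2) \<longlonglongrightarrow> norm (1 - of_real r * w) powr (2 * s)" if w: "norm w = 1" for w :: complex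
    proof -
      have nz: "1 - of_real r * w \<noteq> 0"
      proof
        assume "1 - of_real r * w = 0"
        then have "norm (of_real r * w) = norm (1 :: complex)" by simp
        then show False using r w by (simp add: norm_mult)
      qed
      have "(\<lambda>J. 1 - (\<Sum>j=1..J. of_real (binom_coeff s j) * (of_real r * w) ^ j))
          \<longlonglongrightarrow> (1 - of_real r * w) powr of_real s"
        by (rule one_minus_binom_series_tendsto) (use r w in \<open>simp add: norm_mult\<close>)
      then have "(\<lambda>J. (?f J w)\<^sup>2) \<longlonglongrightarrow> (norm ((1 - of_real r * w) powr of_real s))\<^sup>2"
        by (intro tendsto_intros) (simp add: c_def power_mult_distrib mult.assoc)
      also have "(norm ((1 - of_real r * w) powr of_real s))\<^sup>2 = norm (1 - of_real r * w) powr (2 * s)"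
        using nz by (simp add: norm_powr_real_powr' powr_power mult.commute)
      finally show ?thesis .
    qed
    then show "(\<lambda>J. \<Sum>a=1..N. (1 - real a / real N) * (?f J (cis (real a * x)))\<^sup>2)
      \<longlonglongrightarrow> (\<Sum>a=1..N. (1 - real a / real N) * norm (1 - of_real r * cis (real a * x)) powr (2 * s))"
      by (intro tendsto_sum tendsto_mult tendsto_const) simp
    have "(\<Sum>a=1..N. (1 - real a / real N) * (?f J (cis (real a * x)))\<^sup>2) \<le> real N / 2 * (1 + 2 * s\<^sup>2)" for J
    proof -
      have "(\<Sum>a=1..N. (1 - real a / real N) * (?f J (cis (real a * x)))\<^sup>2)
          \<le> real N / 2 * (1 + (\<Sum>j=1..J. (c j)\<^sup>2))"
        by (rule fejer_mean_norm_sq_le[OF N c0 cdec csum])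
      also have "\<dots> \<le> real N / 2 * (1 + 2 * s\<^sup>2)"
        using csq[of J] by (intro mult_left_mono) auto
      finally show ?thesis .
    qed
    then show "\<exists>n. \<forall>J\<ge>n. (\<Sum>a=1..N. (1 - real a / real N) * (?f J (cis (real a * x)))\<^sup>2)
        \<le> real N / 2 * (1 + 2 * s\<^sup>2)" by blast
  qed
  show ?thesis
  proof (rule tendsto_upperbound)
    show "((\<lambda>r. \<Sum>a=1..N. (1 - real a / real N) * norm (1 - of_real r * cis (real a * x)) powr (2 * s))
       \<longlongrightarrow> (\<Sum>a=1..N. (1 - real a / real N) * norm (1 - cis (real a * x)) powr (2 * s))) (at_left 1)"
    \<comment> \<open>The base tends to 0 where \<open>cis (real a * x) = 1\<close>; the limit of
      the power is still valid there because the exponent is positive.\<close>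
    proof (intro tendsto_sum tendsto_mult tendsto_const tendsto_powr2)
      fix a
      have "((\<lambda>r. norm (1 - of_real r * cis (real a * x))) \<longlongrightarrow> norm (1 - of_real 1 * cis (real a * x))) (at_left 1)"
        by (intro tendsto_intros)
      then show "((\<lambda>r. norm (1 - of_real r * cis (real a * x))) \<longlongrightarrow> norm (1 - cis (real a * x))) (at_left 1)"
        by simp
    qed (use s in auto)
    have "eventually (\<lambda>r::real. r \<in> {0<..<1}) (at_left 1)"
      by (rule eventually_at_left_real) simp
    then show "\<forall>\<^sub>F r in at_left 1. (\<Sum>a=1..N. (1 - real a / real N) * norm (1 - of_real r * cis (real a * x)) powr (2 * s))
        \<le> real N / 2 * (1 + 2 * s\<^sup>2)"
      by eventually_elim (rule inside, auto)
  qed simp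
qed

section \<open>Polynomials on roots of unity\<close>

text \<open>Discrete Fourier inversion: powers with distinct exponents below K are orthogonal on the
  roots of unity of order K, by a geometric sum, and the degree bound excludes aliasing.\<close>

lemma sum_poly_roots_unity:
  fixes p :: "complex poly" and K m :: nat
  defines "u \<equiv> cis (2 * pi / real K)"
  assumes deg: "degree p < K" and m: "m < K"
  shows "(\<Sum>k<K. poly p (u ^ k) / (u ^ k) ^ m) = of_nat K * coeff p m"
proof -
  have K: "K > 0" using m by simp
  have u_pow: "u ^ k = cis (2 * pi * real k / real K)" for k
    by (simp add: u_def Complex.DeMoivre mult_ac)
  have uK: "u ^ K = 1" using K by (simp add: u_pow)
  have u0: "u \<noteq> 0" by (simp add: u_def)
  have inj: "i = m" if "u ^ i = u ^ m" "i < K" for i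
    using Complex.bij_betw_roots_unity[OF K] that m
    by (auto simp: bij_betw_def inj_on_def u_pow)
  have orth: "(\<Sum>k<K. (u ^ k) ^ i / (u ^ k) ^ m) = (if i = m then of_nat K else 0)" if i: "i < K" for i
  proof -
    have "(\<Sum>k<K. (u ^ k) ^ i / (u ^ k) ^ m) = (\<Sum>k<K. (u ^ i / u ^ m) ^ k)"
      by (simp add: power_divide power_mult[symmetric] mult.commute)
    also have "\<dots> = (if i = m then of_nat K else 0)"
    proof (cases "i = m")
      case False
      then have "u ^ i / u ^ m \<noteq> 1" using inj[OF _ i] u0 by auto
      moreover have "(u ^ i / u ^ m) ^ K = 1"
        by (simp add: power_divide power_mult[symmetric] mult.commute[of _ K])
          (simp add: power_mult uK u0)
      ultimately show ?thesis using False by (simp add: geometric_sum)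
    qed (simp add: u0)
    finally show ?thesis .
  qed
  have poly: "poly p z = (\<Sum>i<K. coeff p i * z ^ i)" for z
    unfolding poly_altdef
    by (rule sum.mono_neutral_left) (use deg in \<open>auto simp: coeff_eq_0\<close>)
  have "(\<Sum>k<K. poly p (u ^ k) / (u ^ k) ^ m) = (\<Sum>k<K. \<Sum>i<K. coeff p i * ((u ^ k) ^ i / (u ^ k) ^ m))"
    by (simp add: poly sum_divide_distrib)
  also have "\<dots> = (\<Sum>i<K. coeff p i * (\<Sum>k<K. (u ^ k) ^ i / (u ^ k) ^ m))"
    by (subst sum.swap) (simp add: sum_distrib_left)
  also have "\<dots> = (\<Sum>i<K. if i = m then coeff p i * of_nat K else 0)"
    by (intro sum.cong refl) (simp add: orth)
  also have "\<dots> = of_nat K * coeff p m"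
    using m by simp
  finally show ?thesis .
qed

text \<open>Each coefficient is an average of values at roots of unity times unimodular factors,
  hence at most B in modulus, and there are at most K coefficients.\<close>

lemma norm_poly_le_roots_unity:
  fixes p :: "complex poly"
  assumes deg: "degree p < K" and z: "norm z = 1"
    and B: "\<And>w. w ^ K = 1 \<Longrightarrow> norm (poly p w) \<le> B"
  shows "norm (poly p z) \<le> real K * B"
proof -
  have K: "K > 0" using deg by simp
  define u where "u = cis (2 * pi / real K)"
  have B0: "0 \<le> B" using B[of 1] norm_ge_zero order_trans by (metis power_one)
  have "norm (coeff p m) \<le> B" if m: "m < K" for m
  proof -
    have "real K * norm (coeff p m) = norm (\<Sum>k<K. poly p (u ^ k) / (u ^ k) ^ m)"
      unfolding u_def sum_poly_roots_unity[OF deg m] by (simp add: norm_mult)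
    also have "\<dots> \<le> (\<Sum>k<K. B)"
    proof (rule sum_norm_le)
      fix k
      have "(u ^ k) ^ K = (u ^ K) ^ k" by (simp add: power_mult[symmetric] mult.commute)
      also have "\<dots> = 1" using K by (simp add: u_def Complex.DeMoivre)
      finally have "norm (poly p (u ^ k)) \<le> B" by (rule B)
      then show "norm (poly p (u ^ k) / (u ^ k) ^ m) \<le> B"
        by (simp add: u_def norm_divide norm_power)
    qed
    finally show ?thesis using K by simp
  qed
  then have "norm (poly p z) \<le> (\<Sum>i\<le>degree p. B)"
    unfolding poly_altdef using deg z by (intro sum_norm_le) (simp add: norm_mult norm_power)
  also have "\<dots> \<le> real K * B"
    using deg B0 by (simp add: mult_right_mono del: of_nat_Suc)
  finally show ?thesis .
qed

lemma M_le_roots_unity: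
  assumes A: "finite A" and K: "\<Sum>A < K"
    and B: "\<And>w::complex. w ^ K = 1 \<Longrightarrow> (\<Prod>a\<in>A. norm (1 - w ^ a)) \<le> B"
  shows "M A \<le> real K * B"
proof -
  define p :: "complex poly" where "p = (\<Prod>a\<in>A. 1 - monom 1 a)"
  have p: "norm (poly p z) = (\<Prod>a\<in>A. norm (1 - z ^ a))" for z
    by (simp add: p_def poly_prod poly_monom prod_norm)
  have "degree (1 - monom 1 a :: complex poly) \<le> a" for a
    by (rule degree_diff_le) (auto simp: degree_monom_le)
  then have "(\<Sum>a\<in>A. degree (1 - monom 1 a :: complex poly)) \<le> \<Sum>A"
    by (intro sum_mono)
  with degree_prod_sum_le[OF A, of "\<lambda>a. 1 - monom 1 a :: complex poly"] K
  have "degree p < K" by (simp add: p_def)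
  moreover obtain z :: complex where "norm z = 1" "M A = (\<Prod>a\<in>A. norm (1 - z ^ a))"
    using M_is_max[of A] by auto
  ultimately show ?thesis
    using norm_poly_le_roots_unity[of p K z B] B by (simp add: p)
qed

section \<open>Random subsets\<close>

text \<open>The weight \<open>subset_weight I p A\<close> is the probability of \<open>A\<close> when each \<open>i \<in> I\<close> is selected
  independently with probability \<open>p i\<close>.\<close>

definition subset_weight :: "'a set \<Rightarrow> ('a \<Rightarrow> real) \<Rightarrow> 'a set \<Rightarrow> real" where
  "subset_weight I p A = (\<Prod>i\<in>A. p i) * (\<Prod>i\<in>I - A. 1 - p i)"

lemma subset_weight_nonneg:
  assumes "\<And>i. i \<in> I \<Longrightarrow> 0 \<le> p i \<and> p i \<le> 1" "A \<subseteq> I"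
  shows "0 \<le> subset_weight I p A"
  unfolding subset_weight_def using assms by (intro mult_nonneg_nonneg prod_nonneg) auto

lemma sum_subset_weight: "finite I \<Longrightarrow> (\<Sum>A\<in>Pow I. subset_weight I p A) = 1"
  using prod_add[of I p "\<lambda>i. 1 - p i"] by (simp add: subset_weight_def)

text \<open>Independence factors the mean into terms 1 + p_i (x_i - 1), and 1 + y \<le> e^y.\<close>

lemma subset_mean_prod_le:
  assumes I: "finite I" and p: "\<And>i. i \<in> I \<Longrightarrow> 0 \<le> p i \<and> p i \<le> 1" and x: "\<And>i. i \<in> I \<Longrightarrow> 0 \<le> x i"
  shows "(\<Sum>A\<in>Pow I. subset_weight I p A * (\<Prod>i\<in>A. x i)) \<le> exp (\<Sum>i\<in>I. p i * (x i - 1))"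
proof -
  have "(\<Sum>A\<in>Pow I. subset_weight I p A * (\<Prod>i\<in>A. x i)) = (\<Prod>i\<in>I. p i * x i + (1 - p i))"
    unfolding prod_add[OF I] by (simp add: subset_weight_def prod.distrib mult_ac)
  also have "\<dots> \<le> (\<Prod>i\<in>I. exp (p i * (x i - 1)))"
  proof (rule prod_mono)
    fix i assume i: "i \<in> I"
    show "0 \<le> p i * x i + (1 - p i) \<and> p i * x i + (1 - p i) \<le> exp (p i * (x i - 1))"
      using p[OF i] x[OF i] exp_ge_add_one_self[of "p i * (x i - 1)"]
      by (auto simp: algebra_simps intro: order_trans[of _ 1])
  qed
  finally show ?thesis using I by (simp add: exp_sum)
qed

text \<open>First moment method: the weights are nonnegative with total 1.\<close>

lemma ex_subset_less_of_mean:
  fixes \<Phi> :: "'a set \<Rightarrow> real"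
  assumes I: "finite I" and p: "\<And>i. i \<in> I \<Longrightarrow> 0 \<le> p i \<and> p i \<le> 1"
    and mean: "(\<Sum>A\<in>Pow I. subset_weight I p A * \<Phi> A) < b"
  shows "\<exists>A\<subseteq>I. \<Phi> A < b"
proof (rule ccontr)
  assume "\<not> ?thesis"
  then have "(\<Sum>A\<in>Pow I. subset_weight I p A * b) \<le> (\<Sum>A\<in>Pow I. subset_weight I p A * \<Phi> A)"
    by (intro sum_mono mult_left_mono subset_weight_nonneg p) (auto simp: not_less)
  then show False
    using mean by (simp add: sum_distrib_right[symmetric] sum_subset_weight[OF I])
qed

lemma ex_subset_small_on_roots_unity:
  assumes N: "N \<ge> 10" and s: "0 < s" "s \<le> 1" and K: "K > 0"
  shows "\<exists>A\<subseteq>{1..N}. real N / 8 < real (card A) \<and>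
    (\<forall>w::complex. w ^ K = 1 \<longrightarrow>
      (\<Prod>a\<in>A. norm (1 - w ^ a)) powr (2 * s) \<le> 4 * real K * exp (1/2 + s\<^sup>2 * real N))"
proof -
  define p where "p a = 1 - real a / real N" for a :: nat
  define Z where "Z = {w::complex. w ^ K = 1}"
  define F where "F w A = (\<Prod>a\<in>A. norm (1 - w ^ a)) powr (2 * s)" for w :: complex and A :: "nat set"
  define E where "E = exp (1/2 + s\<^sup>2 * real N)"
  define W where "W = subset_weight {1..N} p"
  \<comment> \<open>Both summands are nonnegative, so \<open>\<Phi> A < 1\<close> makes each less
    than 1: the first then bounds every \<open>F w A\<close>, the second forces
    \<open>card A\<close> above N/8. Their means are at most 1/4 and 1/2.\<close>
  define \<Phi> where "\<Phi> A = (\<Sum>w\<in>Z. F w A) / (4 * real K * E) + exp (real N / 8) * (\<Prod>a\<in>A. exp (- 1))" for A :: "nat set"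
  have p: "0 \<le> p a \<and> p a \<le> 1" if "a \<in> {1..N}" for a using that by (simp add: p_def)
  have Psum: "(\<Sum>a=1..N. p a) = (real N - 1) / 2"
    using sum_fejer_weights[of N] N by (simp add: p_def)
  have Z: "finite Z" "card Z = K"
    using K card_roots_unity_eq[of K] finite_nth_roots[of K 1] by (auto simp: Z_def)
  have meanF: "(\<Sum>A\<in>Pow {1..N}. W A * F w A) \<le> E" if w: "w \<in> Z" for w
  proof -
    have "norm w ^ K = 1" using w by (simp add: Z_def norm_power[symmetric])
    then have "norm w = 1" using K power_eq_imp_eq_base[of "norm w" K 1] by simp
    then have w_pow: "w ^ a = cis (real a * Arg w)" for a
      using cis_Arg[of w] by (cases "w = 0") (auto simp: Complex.DeMoivre[symmetric] sgn_eq)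
    have "(\<Sum>A\<in>Pow {1..N}. W A * F w A)
        = (\<Sum>A\<in>Pow {1..N}. W A * (\<Prod>a\<in>A. norm (1 - w ^ a) powr (2 * s)))"
      by (simp add: F_def prod_powr_distrib)
    also have "\<dots> \<le> exp (\<Sum>a=1..N. p a * (norm (1 - w ^ a) powr (2 * s) - 1))"
      unfolding W_def by (rule subset_mean_prod_le) (use p in auto)
    \<comment> \<open>The total weight (N - 1)/2 cancels the main term N/2 of the Fejer mean,
      leaving 1/2 + s^2 N.\<close>
    also have "(\<Sum>a=1..N. p a * (norm (1 - w ^ a) powr (2 * s) - 1)) \<le> 1/2 + s\<^sup>2 * real N"
    proof -
      have "(\<Sum>a=1..N. p a * norm (1 - w ^ a) powr (2 * s)) \<le> real N / 2 * (1 + 2 * s\<^sup>2)"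
        unfolding p_def w_pow by (rule fejer_mean_norm_powr_le) (use N s in auto)
      then show ?thesis
        unfolding right_diff_distrib sum_subtractf mult_1_right Psum by (simp add: field_simps)
    qed
    finally show ?thesis by (simp add: E_def)
  qed
  have "(\<Sum>A\<in>Pow {1..N}. W A * (\<Sum>w\<in>Z. F w A)) = (\<Sum>w\<in>Z. \<Sum>A\<in>Pow {1..N}. W A * F w A)"
    unfolding sum_distrib_left by (rule sum.swap)
  also have "\<dots> \<le> (\<Sum>w\<in>Z. E)" by (intro sum_mono meanF)
  finally have mean1: "(\<Sum>A\<in>Pow {1..N}. W A * (\<Sum>w\<in>Z. F w A)) \<le> real K * E" using Z by simp
  have e2: "exp (- 1) \<le> (1/2 :: real)"
    using exp_ge_add_one_self[of "1::real"] by (simp add: exp_minus field_simps)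
  \<comment> \<open>A Chernoff bound for the lower tail of \<open>card A\<close>. The condition N
    \<ge> 10 is what makes N/8 - (N - 1)/4 at most -1.\<close>
  have "(\<Sum>A\<in>Pow {1..N}. W A * (\<Prod>a\<in>A. exp (- 1))) \<le> exp (\<Sum>a=1..N. p a * (exp (- 1) - 1))"
    unfolding W_def by (rule subset_mean_prod_le) (use p in auto)
  also have "\<dots> \<le> exp (- ((real N - 1) / 4))"
    unfolding sum_distrib_right[symmetric] Psum
    using mult_left_mono[of "exp (- 1) - 1" "- (1/2)" "(real N - 1) / 2"] e2 N by simp
  finally have "exp (real N / 8) * (\<Sum>A\<in>Pow {1..N}. W A * (\<Prod>a\<in>A. exp (- 1)))
      \<le> exp (real N / 8) * exp (- ((real N - 1) / 4))"
    by (intro mult_left_mono) auto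
  also have "\<dots> = exp (real N / 8 - (real N - 1) / 4)" by (simp add: exp_add[symmetric])
  also have "\<dots> \<le> exp (- 1)" using N by (simp add: field_simps)
  finally have mean2: "exp (real N / 8) * (\<Sum>A\<in>Pow {1..N}. W A * (\<Prod>a\<in>A. exp (- 1))) \<le> 1/2"
    using e2 by linarith
  have "(\<Sum>A\<in>Pow {1..N}. W A * \<Phi> A) = (\<Sum>A\<in>Pow {1..N}. W A * (\<Sum>w\<in>Z. F w A)) / (4 * real K * E)
      + exp (real N / 8) * (\<Sum>A\<in>Pow {1..N}. W A * (\<Prod>a\<in>A. exp (- 1)))"
    unfolding \<Phi>_def distrib_left sum.distrib
    unfolding times_divide_eq_right sum_divide_distrib[symmetric]
      mult.left_commute[of _ "exp (real N / 8)"] sum_distrib_left[symmetric, of "exp (real N / 8)"] ..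
  also have "\<dots> \<le> 1/4 + 1/2"
    using mean1 mean2 K by (intro add_mono) (auto simp: E_def field_simps)
  also have "\<dots> < 1" by simp
  finally obtain A where A: "A \<subseteq> {1..N}" "\<Phi> A < 1"
    using ex_subset_less_of_mean[of "{1..N}" p \<Phi> 1] p unfolding W_def by blast
  have E0: "0 < 4 * real K * E" using K by (simp add: E_def)
  have F0: "0 \<le> F w A" for w by (simp add: F_def)
  have "exp (real N / 8) * (\<Prod>a\<in>A. exp (- 1)) = exp (real N / 8 - real (card A))"
    by (simp add: exp_of_nat_mult[symmetric] exp_add[symmetric])
  moreover have "0 \<le> (\<Sum>w\<in>Z. F w A) / (4 * real K * E)"
    using F0 E0 by (intro divide_nonneg_pos sum_nonneg) auto
  ultimately have "exp (real N / 8 - real (card A)) < 1"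
    using A(2) unfolding \<Phi>_def by linarith
  then have "real N / 8 < real (card A)" by simp
  moreover have "F w A \<le> 4 * real K * E" if "w \<in> Z" for w
  proof -
    have "0 \<le> exp (real N / 8) * (\<Prod>a\<in>A. exp (- 1))"
      by (simp add: prod_nonneg)
    then have "(\<Sum>w\<in>Z. F w A) / (4 * real K * E) < 1"
      using A(2) unfolding \<Phi>_def by linarith
    then have "(\<Sum>w\<in>Z. F w A) < 4 * real K * E" using E0 by (simp add: field_simps)
    moreover have "F w A \<le> (\<Sum>w\<in>Z. F w A)"
      using that Z F0 by (intro member_le_sum) auto
    ultimately show ?thesis by simp
  qed
  ultimately show ?thesis using A(1) by (auto simp: F_def Z_def E_def)
qed

section \<open>Choice of the exponent and the resulting bound for M\<close>

lemma ex_subset_M_le: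
  assumes N: "N \<ge> 16"
  shows "\<exists>A\<subseteq>{1..N}. real N / 8 < real (card A) \<and> M A \<le> exp (5 * sqrt (real N * ln (real N)))"
proof -
  define L where "L = ln (real N)"
  \<comment> \<open>The logarithm of the bound on the product is about (3 L + s^2 N) / (2 s); this
    \<open>s\<close> makes s^2 N equal to L, so that both terms have order sqrt (N L).\<close>
  define s where "s = sqrt (L / real N)"
  \<comment> \<open>The elements of \<open>A\<close> sum to at most N^2, so this order exceeds the
    degree of the polynomial.\<close>
  define K where "K = N\<^sup>2 + 1"
  have N0: "real N > 0" using N by simp
  have L0: "L > 0" using N by (simp add: L_def)
  have LN: "L \<le> real N" unfolding L_def using ln_le_minus_one[OF N0] by simp
  have s: "0 < s" "s \<le> 1" using L0 LN N0 by (auto simp: s_def field_simps)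
  have s2: "s\<^sup>2 * real N = L" using L0 N0 by (simp add: s_def)
  have LS: "L \<le> sqrt (real N * L)"
    using L0 LN by (intro real_le_rsqrt) (simp add: power2_eq_square mult_right_mono)
  have Ls: "L / s = sqrt (real N * L)"
    using L0 N0 real_div_sqrt[of L]
    by (simp add: s_def real_sqrt_divide real_sqrt_mult field_simps)
  have expL: "exp (real k * L) = real N ^ k" for k
    using N0 by (simp add: L_def exp_of_nat_mult)
  \<comment> \<open>Here N \<ge> 16 enters: 16 = 4 * 2 * 2 collects the factor 4, the 2 in
    \<open>K_le\<close> and the bound 2 for e^(1/2).\<close>
  have N2: "16 * (real N)\<^sup>2 \<le> real N ^ 3"
    using N by (simp add: power3_eq_cube power2_eq_square mult_right_mono)
  have K_le: "real K \<le> 2 * (real N)\<^sup>2"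
    using N one_le_power[of "real N" 2] by (simp add: K_def)
  have "exp (1/2 :: real) \<le> 2"
  proof -
    have "(exp (1/2 :: real))\<^sup>2 = exp 1" by (simp add: exp_double[symmetric])
    also have "\<dots> \<le> 2\<^sup>2" using exp_le by simp
    finally show ?thesis by (rule power2_le_imp_le) simp
  qed
  then have "4 * real K * exp (1/2) \<le> 4 * (2 * (real N)\<^sup>2) * 2"
    using K_le by (intro mult_mono) auto
  also have "\<dots> \<le> exp (3 * L)" using N2 expL[of 3] by simp
  finally have KE: "4 * real K * exp (1/2 + L) \<le> exp (4 * L)"
    unfolding exp_add using mult_right_mono[of "4 * real K * exp (1/2)" "exp (3 * L)" "exp L"]
    by (simp add: exp_add[symmetric] mult.assoc)
  have K3: "real K \<le> exp (3 * sqrt (real N * L))"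
  proof -
    have "real K \<le> real N ^ 3" using K_le N2 zero_le_power2[of "real N"] by linarith
    also have "\<dots> = exp (3 * L)" using expL[of 3] by simp
    also have "exp (3 * L) \<le> exp (3 * sqrt (real N * L))" using LS by simp
    finally show ?thesis .
  qed
  obtain A where A: "A \<subseteq> {1..N}" "real N / 8 < real (card A)"
    and F: "\<And>w::complex. w ^ K = 1 \<Longrightarrow>
      (\<Prod>a\<in>A. norm (1 - w ^ a)) powr (2 * s) \<le> 4 * real K * exp (1/2 + s\<^sup>2 * real N)"
    using ex_subset_small_on_roots_unity[of N s K] N s by (auto simp: K_def)
  have "M A \<le> real K * exp (2 * sqrt (real N * L))"
  proof (rule M_le_roots_unity)
    show finA: "finite A" using A finite_subset by blast
    have "\<Sum>A \<le> \<Sum>{1..N}" using A by (intro sum_mono2) auto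
    also have "\<dots> \<le> (\<Sum>a=1..N. N)" by (intro sum_mono) auto
    finally show "\<Sum>A < K" by (simp add: K_def power2_eq_square)
    fix w :: complex assume w: "w ^ K = 1"
    let ?F = "\<Prod>a\<in>A. norm (1 - w ^ a)"
    \<comment> \<open>Undoing the power 2s turns e^(4L) into exp (2 L / s), and L / s = sqrt (N L).
      The factor \<open>K\<close> later adds 3 to the coefficient 2, giving 5.\<close>
    have "?F = (?F powr (2 * s)) powr (1 / (2 * s))"
      using s by (simp add: powr_powr prod_nonneg)
    also have "\<dots> \<le> exp (4 * L) powr (1 / (2 * s))"
      using F[OF w] KE s s2 by (intro powr_mono2) auto
    also have "\<dots> = exp (2 * sqrt (real N * L))"
      using s Ls[symmetric] by (simp add: exp_powr_real)
    finally show "?F \<le> exp (2 * sqrt (real N * L))" .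
  qed
  also have "\<dots> \<le> exp (3 * sqrt (real N * L)) * exp (2 * sqrt (real N * L))"
    using K3 by (intro mult_right_mono) auto
  finally show ?thesis using A by (auto simp: exp_add[symmetric] L_def)
qed

theorem proposition1p1:
  shows "\<exists>c c1 c2 :: real. c > 0 \<and> c1 > 0 \<and> c2 > 0 \<and>
    (\<forall>\<^sub>F N :: nat in sequentially. \<exists>A :: nat set. A \<subseteq> {1..N} \<and>
       c1 * (real N / 2) \<le> real (card A) \<and> real (card A) \<le> c2 * (real N / 2) \<and>
       M A < exp (c * sqrt (real (card A)) * sqrt (ln (real (card A)))
                    * ln (ln (real (card A)))))"
proof (intro exI conjI)
  \<comment> \<open>The constants 1/4 and 2 express N/8 < n \<le> N. From N \<le> 8n and ln N \<le>
    2 ln n the exponent is at most 5 * sqrt 16 = 20 times sqrt (n ln n); 21 makes the inequality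
    strict.\<close>
  show "\<forall>\<^sub>F N :: nat in sequentially. \<exists>A :: nat set. A \<subseteq> {1..N} \<and>
       (1/4) * (real N / 2) \<le> real (card A) \<and> real (card A) \<le> 2 * (real N / 2) \<and>
       M A < exp (21 * sqrt (real (card A)) * sqrt (ln (real (card A)))
                    * ln (ln (real (card A))))"
    \<comment> \<open>The first term ensures n \<ge> e^e, so that ln (ln n) \<ge> 1 and this factor
      may be inserted for free. The 64 ensures n \<ge> 8, hence N \<le> 8n \<le> n^2.\<close>
    using eventually_ge_at_top[of "nat \<lceil>8 * exp (exp 1 :: real)\<rceil> + 64"]
  proof eventually_elim
    case (elim N)
    then obtain A where A: "A \<subseteq> {1..N}" "real N / 8 < real (card A)"
        and MA: "M A \<le> exp (5 * sqrt (real N * ln (real N)))"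
      using ex_subset_M_le[of N] by auto
    let ?n = "real (card A)"
    have "card A \<le> N" using card_mono[OF _ A(1)] by simp
    have n8: "8 \<le> ?n" and N0: "real N > 0" and Nn: "real N \<le> 8 * ?n" using A(2) elim by auto
    have "8 * exp (exp 1 :: real) \<le> real N" using elim by linarith
    then have nee: "exp (exp 1) \<le> ?n" using Nn by linarith
    then have "exp 1 \<le> ln ?n" using n8 by (subst ln_ge_iff) auto
    then have ln1: "0 < ln ?n" and lnln: "1 \<le> ln (ln ?n)"
      using exp_gt_zero[of "1::real"] ln_ge_iff[of "ln ?n" 1] by linarith+
    have "real N \<le> ?n * ?n"
      using Nn mult_right_mono[OF n8, of ?n] by linarith
    then have "ln (real N) \<le> ln (?n * ?n)"
      using N0 by (intro ln_mono) auto
    also have "\<dots> = 2 * ln ?n" using n8 by (simp add: ln_mult)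
    finally have "real N * ln (real N) \<le> 8 * ?n * (2 * ln ?n)"
      using Nn n8 elim by (intro mult_mono) auto
    then have "sqrt (real N * ln (real N)) \<le> sqrt (16 * (?n * ln ?n))"
      by (intro real_sqrt_le_mono) simp
    also have "\<dots> = 4 * (sqrt ?n * sqrt (ln ?n))" by (simp add: real_sqrt_mult)
    finally have "5 * sqrt (real N * ln (real N)) \<le> 20 * (sqrt ?n * sqrt (ln ?n)) * 1" by simp
    also have "\<dots> < 21 * (sqrt ?n * sqrt (ln ?n)) * 1"
      using n8 ln1 by simp
    also have "\<dots> \<le> 21 * (sqrt ?n * sqrt (ln ?n)) * ln (ln ?n)"
      using lnln n8 ln1 by (intro mult_left_mono) auto
    finally have "exp (5 * sqrt (real N * ln (real N)))
        < exp (21 * sqrt ?n * sqrt (ln ?n) * ln (ln ?n))"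
      by (simp add: mult.assoc)
    with MA have "M A < exp (21 * sqrt ?n * sqrt (ln ?n) * ln (ln ?n))"
      by linarith
    then show ?case using A \<open>card A \<le> N\<close> by (intro exI[of _ A]) auto
  qed
qed auto

end
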